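(* Let $B/\mathbb F_q$ be a finite étale cubic algebra with $\operatorname{char}\mathbb F_q\ne2,3$, let $\gamma\in B^\times$, let $\omega\in B$ generate $B$ as an $\mathbb F_q$-algebra, and let $C\subset\mathbb F_q^\times$ be nonempty. Let $X_{C,\gamma}=\{h\in B^\times:\operatorname{Norm}(h)\in C,\ \operatorname{Tr}(\gamma h)=0\}$ and $X^{\rm sing}_{C,\gamma}=\{h\in X_{C,\gamma}:\operatorname{Tr}(\omega\gamma h)=0\}$. Let $f_\omega$ be the characteristic polynomial of multiplication by $\omega$ on $B$ and $D_\omega=\operatorname{disc}(f_\omega)$. Then \[ \#X^{\rm sing}_{C,\gamma}=\sum_{\delta\in C}\#\{u\in\mathbb F_q^\times:u^3=-\operatorname{Norm}(\gamma)\delta D_\omega\},\qquad \#X_{C,\gamma}=\sum_{\delta\in C}N_B(\operatorname{Norm}(\gamma)\delta), \] so the transverse count $\#(X_{C,\gamma}\setminus X^{\rm sing}_{C,\gamma})$ is the difference of these. For a single fiber $C=\{\delta\}$ the singular count is $1$ if $q\equiv2\pmod3$; $3$ if $q\equiv1\pmod3$ and $-\operatorname{Norm}(\gamma)\delta D_\omega\in(\mathbb F_q^\times)^3$; and $0$ if $q\equiv1\pmod 3$ and $-\operatorname{Norm}(\gamma)\delta D_\omega\notin(\mathbb F_q^\times)^3$.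
   Context: Traces and norms are $\operatorname{Tr}_{B/\mathbb F_q}$, $\operatorname{Norm}_{B/\mathbb F_q}$. For $\varepsilon\in\mathbb F_q^\times$, $N_B(\varepsilon)=\#\{x\in B^\times:\operatorname{Tr}(x)=0,\ \operatorname{Norm}(x)=\varepsilon\}$. *)

theory Defs
  imports
    "HOL-Library.Cardinality"
    "Jordan_Normal_Form.Char_Poly"
    "Subresultants.Resultant_Prelim"
begin

locale comm_algebra = vector_space scale
  for scale :: "'k::field \<Rightarrow> 'b::comm_ring_1 \<Rightarrow> 'b" +
  assumes scale_mult_left: "scale a (x * y) = scale a x * y"

definition alg_eval :: "('k::field \<Rightarrow> 'b::comm_ring_1 \<Rightarrow> 'b) \<Rightarrow> 'k poly \<Rightarrow> 'b \<Rightarrow> 'b" where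
  "alg_eval scale p x = (\<Sum>i\<le>degree p. scale (coeff p i) (x ^ i))"

text \<open>For an idempotent \<open>e\<close>, the ideal \<open>e B\<close> is a ring with identity \<open>e\<close> and a \<open>k\<close>-algebra
  via \<open>c \<mapsto> scale c e\<close>. The evaluation of \<open>p\<close> at \<open>x \<in> e B\<close> in this algebra is
  \<open>e * alg_eval scale p x\<close>, as the constant term has to be multiplied by \<open>e\<close>.
  In a field extension, the irreducible polynomials annihilating \<open>x\<close> are the unit multiples of
  the minimal polynomial of \<open>x\<close>.\<close>

definition separable_field_factor :: "('k::field \<Rightarrow> 'b::comm_ring_1 \<Rightarrow> 'b) \<Rightarrow> 'b \<Rightarrow> bool" where
  "separable_field_factor scale e \<longleftrightarrow>
     e * e = e \<and> e \<noteq> 0 \<and>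
     (\<forall>x\<in>range ((*) e). x \<noteq> 0 \<longrightarrow> (\<exists>y\<in>range ((*) e). x * y = e)) \<and>
     (\<forall>x\<in>range ((*) e). \<exists>p. irreducible p \<and> e * alg_eval scale p x = 0 \<and> coprime p (pderiv p))"

text \<open>A finite etale algebra over a field is a finite product of finite separable field
  extensions. The product decomposition is expressed internally: \<open>B\<close> is the product of the
  ideals \<open>e B\<close> for a complete finite system \<open>E\<close> of orthogonal idempotents.\<close>

definition finite_etale_algebra :: "('k::field \<Rightarrow> 'b::comm_ring_1 \<Rightarrow> 'b) \<Rightarrow> bool" where
  "finite_etale_algebra scale \<longleftrightarrow>
     comm_algebra scale \<and>
     (\<exists>S. finite S \<and> module.span scale S = UNIV) \<and>
     (\<exists>E. finite E \<and> \<Sum>E = 1 \<and> (\<forall>e\<in>E. \<forall>e'\<in>E. e \<noteq> e' \<longrightarrow> e * e' = 0) \<and>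
          (\<forall>e\<in>E. separable_field_factor scale e))"

definition finite_etale_cubic_algebra :: "('k::field \<Rightarrow> 'b::comm_ring_1 \<Rightarrow> 'b) \<Rightarrow> bool" where
  "finite_etale_cubic_algebra scale \<longleftrightarrow>
     finite_etale_algebra scale \<and> vector_space.dim scale (UNIV :: 'b set) = 3"

definition subalgebra :: "('k::field \<Rightarrow> 'b::comm_ring_1 \<Rightarrow> 'b) \<Rightarrow> 'b set \<Rightarrow> bool" where
  "subalgebra scale A \<longleftrightarrow>
     module.subspace scale A \<and> 1 \<in> A \<and> (\<forall>x\<in>A. \<forall>y\<in>A. x * y \<in> A)"

definition generates_algebra :: "('k::field \<Rightarrow> 'b::comm_ring_1 \<Rightarrow> 'b) \<Rightarrow> 'b \<Rightarrow> bool" where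
  "generates_algebra scale w \<longleftrightarrow> subalgebra scale hull {w} = UNIV"

text \<open>Trace, norm and characteristic polynomial of an element are those of the matrix of
  multiplication by it. The basis is arbitrary, since they do not depend on it.\<close>

definition alg_basis :: "('k::field \<Rightarrow> 'b::comm_ring_1 \<Rightarrow> 'b) \<Rightarrow> 'b list" where
  "alg_basis scale =
     (SOME bs. distinct bs \<and> \<not> module.dependent scale (set bs) \<and> module.span scale (set bs) = UNIV)"

definition mult_matrix :: "('k::field \<Rightarrow> 'b::comm_ring_1 \<Rightarrow> 'b) \<Rightarrow> 'b \<Rightarrow> 'k mat" where
  "mult_matrix scale x =
     (let bs = alg_basis scale; n = length bs
      in mat n n (\<lambda>(i, j). module.representation scale (set bs) (x * bs ! j) (bs ! i)))"

definition alg_trace :: "('k::field \<Rightarrow> 'b::comm_ring_1 \<Rightarrow> 'b) \<Rightarrow> 'b \<Rightarrow> 'k" where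
  "alg_trace scale x = (\<Sum>i<dim_row (mult_matrix scale x). mult_matrix scale x $$ (i, i))"

definition alg_norm :: "('k::field \<Rightarrow> 'b::comm_ring_1 \<Rightarrow> 'b) \<Rightarrow> 'b \<Rightarrow> 'k" where
  "alg_norm scale x = det (mult_matrix scale x)"

definition alg_char_poly :: "('k::field \<Rightarrow> 'b::comm_ring_1 \<Rightarrow> 'b) \<Rightarrow> 'b \<Rightarrow> 'k poly" where
  "alg_char_poly scale x = char_poly (mult_matrix scale x)"

definition poly_disc :: "'k::field poly \<Rightarrow> 'k" where
  "poly_disc f =
     (-1) ^ (degree f * (degree f - 1) div 2) * resultant f (pderiv f) / lead_coeff f"

definition elem_disc :: "('k::field \<Rightarrow> 'b::comm_ring_1 \<Rightarrow> 'b) \<Rightarrow> 'b \<Rightarrow> 'k" where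
  "elem_disc scale w = poly_disc (alg_char_poly scale w)"

definition trace_zero_count :: "('k::field \<Rightarrow> 'b::comm_ring_1 \<Rightarrow> 'b) \<Rightarrow> 'k \<Rightarrow> nat" where
  "trace_zero_count scale \<epsilon> = card {x. x dvd 1 \<and> alg_trace scale x = 0 \<and> alg_norm scale x = \<epsilon>}"

definition X_set :: "('k::field \<Rightarrow> 'b::comm_ring_1 \<Rightarrow> 'b) \<Rightarrow> 'k set \<Rightarrow> 'b \<Rightarrow> 'b set" where
  "X_set scale C \<gamma> = {h. h dvd 1 \<and> alg_norm scale h \<in> C \<and> alg_trace scale (\<gamma> * h) = 0}"

definition X_sing :: "('k::field \<Rightarrow> 'b::comm_ring_1 \<Rightarrow> 'b) \<Rightarrow> 'b \<Rightarrow> 'k set \<Rightarrow> 'b \<Rightarrow> 'b set" where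
  "X_sing scale \<omega> C \<gamma> = {h \<in> X_set scale C \<gamma>. alg_trace scale (\<omega> * \<gamma> * h) = 0}"

end

theory Submission
  imports Defs
begin

text \<open>Let \<open>f\<close> be the characteristic polynomial of \<open>\<omega>\<close>. By Euler's formula for the dual basis of
  \<open>1, \<omega>, \<omega>\<^sup>2\<close> under the trace form, \<open>Tr x = Tr (\<omega> x) = 0\<close> holds iff \<open>x f'(\<omega>)\<close> is a scalar. As \<open>B\<close>
  is reduced, \<open>f\<close> is squarefree, hence \<open>f'(\<omega>)\<close> is a unit, and its norm is \<open>Res(f, f') = - D\<close>.
  So the singular \<open>h\<close> are the elements \<open>u / (\<gamma> f'(\<omega>))\<close> with \<open>u \<noteq> 0\<close> a scalar, and these have norm
  \<open>- u\<^sup>3 / (Norm \<gamma> D)\<close>. The total count is the substitution \<open>x = \<gamma> h\<close>.\<close>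

section \<open>Determinants and the cubic discriminant\<close>

text \<open>Laplace expansion along the first column. Each minor is again a \<open>mat\<close> of an
  entry function, so the rule can be iterated by rewriting.\<close>

lemma det_mat_Suc:
  fixes f :: "nat \<times> nat \<Rightarrow> 'a::comm_ring_1"
  shows "det (mat (Suc n) (Suc n) f) =
    (\<Sum>i<Suc n. (-1) ^ i * f (i, 0) * det (mat n n (\<lambda>(k, l). f (if k < i then k else Suc k, Suc l))))"
proof -
  have del: "mat_delete (mat (Suc n) (Suc n) f) i 0 =
      mat n n (\<lambda>(k, l). f (if k < i then k else Suc k, Suc l))" if "i < Suc n" for i
    using that by (intro eq_matI) (auto simp: mat_delete_def)
  have "det (mat (Suc n) (Suc n) f) =
      (\<Sum>i<Suc n. mat (Suc n) (Suc n) f $$ (i, 0) * cofactor (mat (Suc n) (Suc n) f) i 0)"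
    by (rule laplace_expansion_column) auto
  also have "\<dots> = (\<Sum>i<Suc n. (-1) ^ i * f (i, 0) * det (mat n n (\<lambda>(k, l). f (if k < i then k else Suc k, Suc l))))"
    by (intro sum.cong refl) (simp add: cofactor_def del algebra_simps)
  finally show ?thesis .
qed

lemma det_mat_3:
  fixes f :: "nat \<times> nat \<Rightarrow> 'a::comm_ring_1"
  shows "det (mat 3 3 f) =
    f (0,0) * (f (1,1) * f (2,2) - f (1,2) * f (2,1))
    - f (1,0) * (f (0,1) * f (2,2) - f (0,2) * f (2,1))
    + f (2,0) * (f (0,1) * f (1,2) - f (0,2) * f (1,1))"
  unfolding numeral_3_eq_3
  by (simp add: det_mat_Suc numeral_2_eq_2 algebra_simps)

text \<open>A 5 by 5 Sylvester determinant. Since 3 is nonzero, the derivative has degree exactly 2,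
  which fixes the shape of the matrix.\<close>

lemma resultant_cubic_pderiv:
  fixes a b c :: "'a::field"
  assumes "(3::'a) \<noteq> 0"
  shows "resultant [:c, b, a, 1:] (pderiv [:c, b, a, 1:]) =
    4 * b ^ 3 + 4 * a ^ 3 * c + 27 * c ^ 2 - a ^ 2 * b ^ 2 - 18 * a * b * c"
proof -
  have d: "pderiv [:c, b, a, 1:] = [:b, 2 * a, 3:]"
    by (simp add: pderiv_pCons)
  have deg: "degree [:c, b, a, 1:] = 3" "degree [:b, 2 * a, 3:] = 2"
    using assms by simp_all
  \<comment> \<open>Entries of the Sylvester matrix: two shifted rows of coefficients of the cubic,
    then three of its derivative.\<close>
  define f where "f = (\<lambda>(i, j).
    if i < 2 then if i \<le> j \<and> j - i \<le> 3 then coeff [:c, b, a, 1:] (3 + i - j) else 0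
    else if i - 2 \<le> j \<and> j \<le> i then coeff [:b, 2 * a, 3:] (i - j) else 0)"
  \<comment> \<open>The indices are towers of \<open>Suc\<close>, the form in which the repeated
    expansion produces them.\<close>
  let ?n1 = "Suc 0" let ?n2 = "Suc ?n1" let ?n3 = "Suc ?n2" let ?n4 = "Suc ?n3"
  have entries:
    "f (0, 0) = 1" "f (0, ?n1) = a" "f (0, ?n2) = b" "f (0, ?n3) = c" "f (0, ?n4) = 0"
    "f (?n1, 0) = 0" "f (?n1, ?n1) = 1" "f (?n1, ?n2) = a" "f (?n1, ?n3) = b" "f (?n1, ?n4) = c"
    "f (?n2, 0) = 3" "f (?n2, ?n1) = 2 * a" "f (?n2, ?n2) = b" "f (?n2, ?n3) = 0" "f (?n2, ?n4) = 0"
    "f (?n3, 0) = 0" "f (?n3, ?n1) = 3" "f (?n3, ?n2) = 2 * a" "f (?n3, ?n3) = b" "f (?n3, ?n4) = 0"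
    "f (?n4, 0) = 0" "f (?n4, ?n1) = 0" "f (?n4, ?n2) = 3" "f (?n4, ?n3) = 2 * a" "f (?n4, ?n4) = b"
    by (simp_all add: f_def numeral_2_eq_2 numeral_3_eq_3)
  have "resultant [:c, b, a, 1:] (pderiv [:c, b, a, 1:]) = det (mat (Suc ?n4) (Suc ?n4) f)"
    unfolding resultant_def sylvester_mat_def sylvester_mat_sub_def d deg f_def
    by (simp add: numeral_eq_Suc)
  \<comment> \<open>The first column has only two nonzero entries, 1 in row 0 and 3 in row 2, both
    with positive sign.\<close>
  also have "\<dots> = det (mat ?n4 ?n4 (\<lambda>(k, l). f (Suc k, Suc l))) +
      3 * det (mat ?n4 ?n4 (\<lambda>(k, l). f (if k < ?n2 then k else Suc k, Suc l)))"
    by (subst det_mat_Suc) (simp only: sum.lessThan_Suc, simp add: entries)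
  also have "\<dots> = 4 * b ^ 3 + 4 * a ^ 3 * c + 27 * c ^ 2 - a ^ 2 * b ^ 2 - 18 * a * b * c"
    by (simp only: det_mat_Suc[of ?n3] sum.lessThan_Suc det_mat_3[unfolded numeral_3_eq_3])
       (simp add: entries numeral_2_eq_2, simp add: algebra_simps power2_eq_square power3_eq_cube)
  finally show ?thesis .
qed

text \<open>In degree 3 the sign is (-1)^3, so for a monic cubic the discriminant is minus the
  resultant.\<close>

lemma poly_disc_cubic:
  fixes a b c :: "'a::field"
  assumes "(3::'a) \<noteq> 0"
  shows "poly_disc [:c, b, a, 1:] =
    a ^ 2 * b ^ 2 + 18 * a * b * c - 4 * b ^ 3 - 4 * a ^ 3 * c - 27 * c ^ 2"
  by (simp add: poly_disc_def resultant_cubic_pderiv[OF assms])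

section \<open>Invariance of the trace under similarity\<close>

lemma trace_mult_comm:
  fixes A :: "'a::comm_ring_1 mat"
  assumes "A \<in> carrier_mat n m" "B \<in> carrier_mat m n"
  shows "(\<Sum>i<n. (A * B) $$ (i, i)) = (\<Sum>i<m. (B * A) $$ (i, i))"
proof -
  have "(\<Sum>i<n. (A * B) $$ (i, i)) = (\<Sum>i<n. \<Sum>j<m. A $$ (i, j) * B $$ (j, i))"
    using assms by (intro sum.cong refl) (auto simp: scalar_prod_def lessThan_atLeast0 intro!: sum.cong)
  also have "\<dots> = (\<Sum>j<m. \<Sum>i<n. B $$ (j, i) * A $$ (i, j))"
    by (subst sum.swap) (simp add: mult.commute)
  also have "\<dots> = (\<Sum>i<m. (B * A) $$ (i, i))"
    using assms by (intro sum.cong refl) (auto simp: scalar_prod_def lessThan_atLeast0 intro!: sum.cong)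
  finally show ?thesis .
qed

lemma trace_similar:
  fixes A :: "'a::comm_ring_1 mat"
  assumes "similar_mat A B"
  shows "(\<Sum>i<dim_row A. A $$ (i, i)) = (\<Sum>i<dim_row B. B $$ (i, i))"
proof -
  from similar_matD[OF assms] obtain n P Q where
    c: "A \<in> carrier_mat n n" "B \<in> carrier_mat n n" "P \<in> carrier_mat n n" "Q \<in> carrier_mat n n"
    and QP: "Q * P = 1\<^sub>m n" and A: "A = P * B * Q"
    by auto
  have "(\<Sum>i<n. A $$ (i, i)) = (\<Sum>i<n. (Q * (P * B)) $$ (i, i))"
    unfolding A by (rule trace_mult_comm) (use c in auto)
  also have "Q * (P * B) = B"
    using c QP by (simp flip: assoc_mult_mat)
  finally show ?thesis using c by simp
qed

section \<open>Matrices of linear maps and change of basis\<close>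

text \<open>The condition under the choice in \<open>alg_basis\<close>, named so that the chosen
  basis can be exchanged for a convenient one.\<close>

definition basis_list :: "('k::field \<Rightarrow> 'b::ab_group_add \<Rightarrow> 'b) \<Rightarrow> 'b list \<Rightarrow> bool" where
  "basis_list scale bs \<longleftrightarrow>
     distinct bs \<and> \<not> module.dependent scale (set bs) \<and> module.span scale (set bs) = UNIV"

text \<open>The source basis \<open>cs\<close> and the target basis \<open>bs\<close> may differ, so
  a change-of-basis matrix is the matrix of the identity map.\<close>

definition lin_matrix ::
    "('k::field \<Rightarrow> 'b::ab_group_add \<Rightarrow> 'b) \<Rightarrow> 'b list \<Rightarrow> 'b list \<Rightarrow> ('b \<Rightarrow> 'b) \<Rightarrow> 'k mat" where
  "lin_matrix scale bs cs f =
     mat (length bs) (length cs) (\<lambda>(i, j). module.representation scale (set bs) (f (cs ! j)) (bs ! i))"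

lemma lin_matrix_carrier [simp]:
  "lin_matrix scale bs cs f \<in> carrier_mat (length bs) (length cs)"
  by (simp add: lin_matrix_def)

context vector_space
begin

lemma lin_matrix_id:
  assumes "basis_list scale bs"
  shows "lin_matrix scale bs bs (\<lambda>x. x) = 1\<^sub>m (length bs)"
  using assms
  by (intro eq_matI)
     (auto simp: lin_matrix_def basis_list_def representation_basis nth_eq_iff_index_eq)

lemma lin_matrix_mult:
  assumes as: "basis_list scale as" and bs: "basis_list scale bs"
    and f: "Vector_Spaces.linear scale scale f"
  shows "lin_matrix scale as bs f * lin_matrix scale bs cs g = lin_matrix scale as cs (\<lambda>x. f (g x))"
proof (intro eq_matI)
  interpret f: Vector_Spaces.linear scale scale f by (rule f)
  fix i j assume "i < dim_row (lin_matrix scale as cs (\<lambda>x. f (g x)))"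
    "j < dim_col (lin_matrix scale as cs (\<lambda>x. f (g x)))"
  then have i: "i < length as" and j: "j < length cs" by (auto simp: lin_matrix_def)
  have ind: "independent (set as)" "independent (set bs)" and
    sp: "span (set as) = UNIV" "span (set bs) = UNIV" and dist: "distinct bs"
    using as bs by (auto simp: basis_list_def)
  let ?r = "representation (set bs) (g (cs ! j))"
  have "(lin_matrix scale as bs f * lin_matrix scale bs cs g) $$ (i, j) =
      (\<Sum>k<length bs. representation (set as) (f (bs ! k)) (as ! i) * ?r (bs ! k))"
    using i j by (auto simp: lin_matrix_def scalar_prod_def lessThan_atLeast0 intro!: sum.cong)
  also have "\<dots> = (\<Sum>b\<in>set bs. representation (set as) (f b) (as ! i) * ?r b)"
    by (intro sum.reindex_bij_betw bij_betw_nth) (use dist in auto)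
  also have "\<dots> = representation (set as) (\<Sum>b\<in>set bs. scale (?r b) (f b)) (as ! i)"
    using ind sp by (simp add: representation_sum representation_scale mult.commute)
  also have "(\<Sum>b\<in>set bs. scale (?r b) (f b)) = f (\<Sum>b\<in>set bs. scale (?r b) b)"
    by (simp add: f.sum f.scale)
  also have "(\<Sum>b\<in>set bs. scale (?r b) b) = g (cs ! j)"
    using ind sp by (intro sum_representation_eq) auto
  finally show "(lin_matrix scale as bs f * lin_matrix scale bs cs g) $$ (i, j) =
      lin_matrix scale as cs (\<lambda>x. f (g x)) $$ (i, j)"
    using i j by (simp add: lin_matrix_def)
qed (simp_all add: lin_matrix_def)

lemma basis_list_length:
  assumes "basis_list scale bs"
  shows "length bs = dim UNIV"
  using assms basis_card_eq_dim[of "set bs" UNIV]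
  by (simp add: basis_list_def distinct_card)

text \<open>The conjugating matrices are those of the identity map between the two bases; all the
  required equations are instances of \<open>lin_matrix_mult\<close>.\<close>

lemma similar_lin_matrix:
  assumes as: "basis_list scale as" and bs: "basis_list scale bs"
    and f: "Vector_Spaces.linear scale scale f"
  shows "similar_mat (lin_matrix scale as as f) (lin_matrix scale bs bs f)"
proof -
  have id: "Vector_Spaces.linear scale scale (\<lambda>x. x)"
    by (rule linear_ident)
  have len: "length as = length bs"
    using as bs by (simp add: basis_list_length)
  let ?P = "lin_matrix scale as bs (\<lambda>x. x)" and ?Q = "lin_matrix scale bs as (\<lambda>x. x)"
  have "similar_mat_wit (lin_matrix scale as as f) (lin_matrix scale bs bs f) ?P ?Q"
  proof (rule similar_mat_witI)
    show "?P * ?Q = 1\<^sub>m (length bs)" "?Q * ?P = 1\<^sub>m (length bs)"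
      using as bs id len by (simp_all add: lin_matrix_mult lin_matrix_id)
    show "lin_matrix scale as as f = ?P * lin_matrix scale bs bs f * ?Q"
      using as bs id f by (simp add: lin_matrix_mult)
  qed (use len in \<open>simp_all add: lin_matrix_def\<close>)
  then show ?thesis unfolding similar_mat_def by blast
qed

end

section \<open>Trace, norm and characteristic polynomial in an arbitrary basis\<close>

lemma basis_list_alg_basisI:
  assumes "comm_algebra scale" "finite S" "module.span scale S = UNIV"
  shows "basis_list scale (alg_basis scale)"
proof -
  interpret comm_algebra scale by (rule assms)
  obtain B where "B \<subseteq> S" "independent B" "S \<subseteq> span B"
    by (rule maximal_independent_subset)
  with assms have "finite B" "independent B" "span B = UNIV"
    by (auto intro: finite_subset) (metis UNIV_I span_mono span_span subsetD)
  moreover obtain bs where "set bs = B" "distinct bs"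
    using \<open>finite B\<close> finite_distinct_list by blast
  ultimately have "\<exists>bs. basis_list scale bs"
    unfolding basis_list_def by blast
  then show ?thesis
    unfolding basis_list_def alg_basis_def by (rule someI_ex)
qed

context comm_algebra
begin

lemma scale_mult_right: "scale a (x * y) = x * scale a y"
  using scale_mult_left[of a y x] by (simp add: mult.commute)

lemma linear_mult: "Vector_Spaces.linear scale scale ((*) x)"
  by unfold_locales (simp_all add: distrib_left scale_mult_right)

text \<open>Distinctness comes along: a coincidence between two of the powers would be a relation
  with coefficients 1 and -1.\<close>

lemma independent_powers_if_scalars_zero:
  assumes ind: "\<And>x y z. scale x 1 + scale y w + scale z (w ^ 2) = 0 \<Longrightarrow> x = 0 \<and> y = 0 \<and> z = 0"
  shows "distinct [1, w, w ^ 2]" "independent {1, w, w ^ 2}"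
proof -
  have d: "1 \<noteq> w" "1 \<noteq> w ^ 2" "w \<noteq> w ^ 2"
    using ind[of 1 "-1" 0] ind[of 1 0 "-1"] ind[of 0 1 "-1"] by auto
  then show "distinct [1, w, w ^ 2]" by simp
  show "independent {1, w, w ^ 2}"
  proof (rule independent_if_scalars_zero)
    fix f x assume "(\<Sum>x\<in>{1, w, w ^ 2}. scale (f x) x) = 0" "x \<in> {1, w, w ^ 2}"
    then show "f x = 0"
      using ind[of "f 1" "f w" "f (w ^ 2)"] d by (auto simp: add.assoc)
  qed simp
qed

lemma mult_matrix_eq_lin_matrix:
  "mult_matrix scale x = lin_matrix scale (alg_basis scale) (alg_basis scale) ((*) x)"
  by (simp add: mult_matrix_def lin_matrix_def Let_def)

end

text \<open>Finite-dimensionality, expressed as the success of the choice in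
  \<open>alg_basis\<close>.\<close>

locale finite_dim_comm_algebra = comm_algebra +
  assumes basis_list_alg_basis: "basis_list scale (alg_basis scale)"
begin

lemma similar_mult_matrix:
  "basis_list scale bs \<Longrightarrow> similar_mat (mult_matrix scale x) (lin_matrix scale bs bs ((*) x))"
  unfolding mult_matrix_eq_lin_matrix
  by (intro similar_lin_matrix basis_list_alg_basis linear_mult)

lemma alg_norm_eq_det_lin_matrix:
  "basis_list scale bs \<Longrightarrow> alg_norm scale x = det (lin_matrix scale bs bs ((*) x))"
  unfolding alg_norm_def by (intro det_similar similar_mult_matrix)

lemma alg_char_poly_eq_char_poly_lin_matrix:
  "basis_list scale bs \<Longrightarrow> alg_char_poly scale x = char_poly (lin_matrix scale bs bs ((*) x))"
  unfolding alg_char_poly_def by (intro char_poly_similar similar_mult_matrix)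

lemma alg_trace_eq_trace_lin_matrix:
  "basis_list scale bs \<Longrightarrow>
    alg_trace scale x = (\<Sum>i<length bs. lin_matrix scale bs bs ((*) x) $$ (i, i))"
  unfolding alg_trace_def using trace_similar[OF similar_mult_matrix[of bs x]]
  by (simp add: lin_matrix_def)

lemma alg_norm_mult: "alg_norm scale (x * y) = alg_norm scale x * alg_norm scale y"
proof -
  let ?M = "\<lambda>x. lin_matrix scale (alg_basis scale) (alg_basis scale) ((*) x)"
  have "?M (x * y) = ?M x * ?M y"
    using lin_matrix_mult[OF basis_list_alg_basis basis_list_alg_basis linear_mult, of x _ "(*) y"]
    unfolding mult.assoc[symmetric, abs_def] by simp
  then show ?thesis
    unfolding alg_norm_eq_det_lin_matrix[OF basis_list_alg_basis]
    by (metis det_mult lin_matrix_carrier)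
qed

lemma alg_norm_1: "alg_norm scale 1 = 1"
  unfolding alg_norm_eq_det_lin_matrix[OF basis_list_alg_basis]
  using lin_matrix_id[OF basis_list_alg_basis] by (simp add: mult_1_left[abs_def])

lemma alg_norm_unit_nonzero: "x dvd 1 \<Longrightarrow> alg_norm scale x \<noteq> 0"
  by (metis alg_norm_1 alg_norm_mult dvdE mult_zero_left zero_neq_one)

text \<open>Every element is a combination of basis vectors, and there are only finitely many
  coefficient families.\<close>

lemma finite_UNIV_algebra:
  assumes "finite (UNIV :: 'a set)"
  shows "finite (UNIV :: 'b set)"
proof -
  let ?B = "set (alg_basis scale)"
  have B: "independent ?B" "span ?B = UNIV"
    using basis_list_alg_basis by (auto simp: basis_list_def)
  have "x \<in> (\<lambda>g. \<Sum>b\<in>?B. scale (g b) b) ` (PiE ?B (\<lambda>_. UNIV))" for x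
  proof
    show "x = (\<Sum>b\<in>?B. scale (restrict (representation ?B x) ?B b) b)"
      using sum_representation_eq[of ?B x ?B] B by simp
  qed (simp add: restrict_PiE_iff del: restrict_apply)
  then have "UNIV \<subseteq> (\<lambda>g. \<Sum>b\<in>?B. scale (g b) b) ` (PiE ?B (\<lambda>_. UNIV))"
    by blast
  moreover have "finite (PiE ?B (\<lambda>_. UNIV :: 'a set))"
    using assms by (intro finite_PiE) auto
  ultimately show ?thesis by (rule finite_subset[OF _ finite_imageI])
qed

end

section \<open>Cubic algebras generated by one element\<close>

text \<open>The algebra k[T]/(f) with f = T^3 + a T^2 + b T + c and T mapped to \<open>w\<close>,
  described by its power basis.\<close>

locale monogenic_cubic_algebra = finite_dim_comm_algebra +
  fixes w :: 'b and a b c :: 'a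
  assumes independent_powers:
      "scale x 1 + scale y w + scale z (w ^ 2) = 0 \<Longrightarrow> x = 0 \<and> y = 0 \<and> z = 0"
    and spanning_powers: "\<exists>x y z. u = scale x 1 + scale y w + scale z (w ^ 2)"
    and min_poly_relation: "w ^ 3 = - scale a (w ^ 2) - scale b w - scale c 1"
begin

text \<open>Coordinates in the power basis. Computing with them turns identities in the algebra into
  polynomial identities over the base field.\<close>

definition comb :: "'a \<Rightarrow> 'a \<Rightarrow> 'a \<Rightarrow> 'b" where
  "comb x y z = scale x 1 + scale y w + scale z (w ^ 2)"

lemma comb_cases: obtains x y z where "u = comb x y z"
  using spanning_powers[of u] by (auto simp: comb_def)

lemma comb_eq_iff: "comb x y z = comb x' y' z' \<longleftrightarrow> x = x' \<and> y = y' \<and> z = z'"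
proof
  assume "comb x y z = comb x' y' z'"
  then have "scale (x - x') 1 + scale (y - y') w + scale (z - z') (w ^ 2) = 0"
    by (simp add: comb_def scale_left_diff_distrib algebra_simps)
  from independent_powers[OF this] show "x = x' \<and> y = y' \<and> z = z'" by simp
qed auto

lemma comb_1: "comb u 0 0 = scale u 1" and comb_w: "comb 0 1 0 = w" and comb_w2: "comb 0 0 1 = w ^ 2"
  by (simp_all add: comb_def)

lemma w_mult_comb: "w * comb x y z = comb (- (c * z)) (x - b * z) (y - a * z)"
proof -
  have "w * comb x y z = scale x w + scale y (w ^ 2) + scale z (w ^ 3)"
    by (simp add: comb_def algebra_simps flip: scale_mult_right)
       (simp add: power2_eq_square power3_eq_cube mult.assoc)
  also have "\<dots> = comb (- (c * z)) (x - b * z) (y - a * z)"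
    unfolding min_poly_relation comb_def
    by (simp add: algebra_simps scale_right_diff_distrib scale_left_diff_distrib)
  finally show ?thesis .
qed

lemma scale_comb: "scale s (comb x y z) = comb (s * x) (s * y) (s * z)"
  by (simp add: comb_def scale_right_distrib)

lemma add_comb: "comb x y z + comb x' y' z' = comb (x + x') (y + y') (z + z')"
  by (simp add: comb_def scale_left_distrib algebra_simps)

text \<open>Reduces every product to repeated multiplication by \<open>w\<close>, for which
  \<open>w_mult_comb\<close> gives the coordinates.\<close>

lemma comb_mult: "u * comb x y z = scale x u + scale y (w * u) + scale z (w * (w * u))"
  by (simp add: comb_def distrib_left power2_eq_square mult.commute mult.left_commute
      flip: scale_mult_right)

lemma distinct_powers: "distinct [1, w, w ^ 2]"
  using independent_powers_if_scalars_zero(1) independent_powers by blast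

lemma basis_list_powers: "basis_list scale [1, w, w ^ 2]"
proof -
  have "independent {1, w, w ^ 2}"
    using independent_powers_if_scalars_zero(2) independent_powers by blast
  moreover have "u \<in> span {1, w, w ^ 2}" for u
    using comb_cases[of u] by (auto simp: comb_def intro!: span_add span_scale intro: span_base)
  ultimately show ?thesis
    using distinct_powers by (auto simp: basis_list_def)
qed

lemma representation_comb:
  "representation {1, w, w ^ 2} (comb x y z) =
    (\<lambda>v. if v = 1 then x else if v = w then y else if v = w ^ 2 then z else 0)"
proof -
  have d: "1 \<noteq> w" "1 \<noteq> w ^ 2" "w \<noteq> w ^ 2"
    using distinct_powers by auto
  have "independent {1, w, w ^ 2}" "span {1, w, w ^ 2} = UNIV"
    using basis_list_powers by (auto simp: basis_list_def)
  then show ?thesis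
    using d by (auto simp: comb_def representation_add representation_scale representation_basis fun_eq_iff)
qed

lemma lin_matrix_comb:
  "lin_matrix scale [1, w, w ^ 2] [1, w, w ^ 2] ((*) (comb x y z)) = mat 3 3 (\<lambda>(i, j).
     [[x, - (c * z), - (c * (y - a * z))],
      [y, x - b * z, - (c * z) - b * (y - a * z)],
      [z, y - a * z, x - b * z - a * (y - a * z)]] ! i ! j)"
proof -
  \<comment> \<open>The columns are the products with the basis vectors, each obtained from the
    previous one by \<open>w_mult_comb\<close>.\<close>
  have cols: "comb x y z * 1 = comb x y z"
    "comb x y z * w = comb (- (c * z)) (x - b * z) (y - a * z)"
    "comb x y z * w ^ 2 = comb (- (c * (y - a * z))) (- (c * z) - b * (y - a * z))
       (x - b * z - a * (y - a * z))"
    by (simp_all add: mult.commute[of "comb x y z"] w_mult_comb power2_eq_square mult.assoc)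
  have d: "1 \<noteq> w" "1 \<noteq> w ^ 2" "w \<noteq> w ^ 2" "w \<noteq> 1" "w ^ 2 \<noteq> 1" "w ^ 2 \<noteq> w"
    using distinct_powers by auto
  show ?thesis (is "?L = ?R")
  proof (rule eq_matI)
    fix i j assume "i < dim_row ?R" "j < dim_col ?R"
    then have "i = 0 \<or> i = 1 \<or> i = 2" "j = 0 \<or> j = 1 \<or> j = 2" by auto
    then show "?L $$ (i, j) = ?R $$ (i, j)"
      by (elim disjE) (simp_all add: lin_matrix_def cols representation_comb d del: mult_1_right)
  qed (simp_all add: lin_matrix_def)
qed

text \<open>The coefficients 3, -a and a^2 - 2 b are the power sums of the roots of f, that is, the
  traces of 1, \<open>w\<close> and \<open>w ^ 2\<close>.\<close>

lemma alg_trace_comb: "alg_trace scale (comb x y z) = 3 * x - a * y + (a ^ 2 - 2 * b) * z"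
  unfolding alg_trace_eq_trace_lin_matrix[OF basis_list_powers] lin_matrix_comb
  by (simp add: numeral_3_eq_3 algebra_simps power2_eq_square)

lemma alg_norm_comb:
  "alg_norm scale (comb x y z) =
    x * ((x - b * z) * (x - b * z - a * (y - a * z)) - (- (c * z) - b * (y - a * z)) * (y - a * z))
    - y * (- (c * z) * (x - b * z - a * (y - a * z)) - (- (c * (y - a * z))) * (y - a * z))
    + z * (- (c * z) * (- (c * z) - b * (y - a * z)) - (- (c * (y - a * z))) * (x - b * z))"
  unfolding alg_norm_eq_det_lin_matrix[OF basis_list_powers] lin_matrix_comb det_mat_3
  by (simp only: case_prod_conv nth_Cons_0 nth_Cons_Suc One_nat_def numeral_2_eq_2)

lemma alg_norm_scale_1: "alg_norm scale (scale u 1) = u ^ 3"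
  unfolding comb_1[symmetric] alg_norm_comb by (simp add: power3_eq_cube)

lemma alg_char_poly_w: "alg_char_poly scale w = [:c, b, a, 1:]"
proof -
  let ?A = "mat 3 3 (\<lambda>(i, j). [[0, 0, - c], [1, 0, - b], [0, 1, - a]] ! i ! j)"
  let ?B = "mat 3 3 (\<lambda>(i, j).
    [[[:0, 1:], 0, [:c:]], [[:-1:], [:0, 1:], [:b:]], [0, [:-1:], [:a, 1:]]] ! i ! j)"
  have "alg_char_poly scale w = char_poly ?A"
    unfolding alg_char_poly_eq_char_poly_lin_matrix[OF basis_list_powers]
    using lin_matrix_comb[of 0 1 0] unfolding comb_w by simp
  also have "\<dots> = det (char_poly_matrix ?A)"
    by (rule char_poly_def)
  also have "char_poly_matrix ?A = ?B"
  proof (rule eq_matI)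
    fix i j assume "i < dim_row ?B" "j < dim_col ?B"
    then have "i = 0 \<or> i = 1 \<or> i = 2" "j = 0 \<or> j = 1 \<or> j = 2" by auto
    then show "char_poly_matrix ?A $$ (i, j) = ?B $$ (i, j)"
      by (elim disjE) (simp_all add: char_poly_matrix_def)
  qed (simp_all add: char_poly_matrix_def)
  also have "det ?B = [:c, b, a, 1:]"
    unfolding det_mat_3 by (simp add: numeral_2_eq_2)
  finally show ?thesis .
qed

text \<open>\<open>comb b (2 * a) 3\<close> is f'(w). Its norm is the resultant of f and f', hence
  minus the discriminant; here both sides are compared as explicit polynomials in the
  coefficients.\<close>

lemma alg_norm_deriv:
  assumes "(3::'a) \<noteq> 0"
  shows "alg_norm scale (comb b (2 * a) 3) = - elem_disc scale w"
proof -
  \<comment> \<open>The values of y - a z and x - b z at the coordinates of f'(w).\<close>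
  have simps: "2 * a - a * 3 = - a" "b - b * 3 = - 2 * b" by simp_all
  show ?thesis
    unfolding alg_norm_comb elem_disc_def alg_char_poly_w poly_disc_cubic[OF assms] simps
    by (simp add: algebra_simps power2_eq_square power3_eq_cube)
qed

text \<open>Euler's formula: the functionals \<open>h \<mapsto> Tr h\<close> and \<open>h \<mapsto> Tr (w h) + a Tr h\<close> read off the
  coordinates of \<open>h f'(w)\<close> at \<open>w\<^sup>2\<close> and \<open>w\<close>.\<close>

lemma comb_mult_deriv:
  "\<exists>u. h * comb b (2 * a) 3 =
     comb u (alg_trace scale (w * h) + a * alg_trace scale h) (alg_trace scale h)"
proof -
  obtain x y z where h: "h = comb x y z" by (rule comb_cases)
  show ?thesis
    unfolding h comb_mult[of "comb x y z"] w_mult_comb scale_comb add_comb alg_trace_comb comb_eq_iff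
    \<comment> \<open>The witness is the constant coordinate of
      \<open>b * h + 2 * a * (w * h) + 3 * (w * (w * h))\<close>, with the scalars acting by
      \<open>scale\<close>.\<close>
    by (rule exI[of _ "b * x + a * c * z - 3 * c * y"]) (simp add: algebra_simps power2_eq_square)
qed

text \<open>The coordinates of h f'(w) at \<open>w\<close> and \<open>w ^ 2\<close> depend on the
  two traces through a triangular invertible system, so they vanish together.\<close>

lemma trace_zero_iff_mult_deriv_scalar:
  "alg_trace scale h = 0 \<and> alg_trace scale (w * h) = 0 \<longleftrightarrow>
    (\<exists>u. h * comb b (2 * a) 3 = scale u 1)"
proof -
  obtain u where "h * comb b (2 * a) 3 =
     comb u (alg_trace scale (w * h) + a * alg_trace scale h) (alg_trace scale h)"
    using comb_mult_deriv by blast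
  then show ?thesis
    unfolding comb_1[symmetric] by (auto simp: comb_eq_iff)
qed

end

section \<open>Etale algebras\<close>

text \<open>Inverses in the factors glue: the sum of the \<open>e * y e\<close> is an inverse of
  \<open>d\<close>.\<close>

lemma inverse_mod_idempotents:
  fixes d :: "'b::comm_ring_1"
  assumes "\<Sum>E = 1" "\<And>e. e \<in> E \<Longrightarrow> \<exists>y. e * d * y = e"
  shows "d dvd 1"
proof -
  obtain y where y: "\<And>e. e \<in> E \<Longrightarrow> e * d * y e = e"
    using assms(2) by metis
  have "d * (\<Sum>e\<in>E. e * y e) = (\<Sum>e\<in>E. e * d * y e)"
    by (simp add: sum_distrib_left algebra_simps)
  also have "\<dots> = 1"
    using y assms(1) by simp
  finally show ?thesis by (metis dvd_triv_left)
qed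

lemma separable_field_factor_inverse:
  assumes "separable_field_factor scale e" "e * x \<noteq> 0"
  obtains y where "e * x * y = e"
  using assms unfolding separable_field_factor_def by (metis rangeI)

text \<open>An element of square zero has zero component in each field factor, and it is the sum of
  its components.\<close>

lemma reduced_if_field_factors:
  fixes x :: "'b::comm_ring_1" and E :: "'b set"
  assumes "\<Sum>E = 1" "\<And>e. e \<in> E \<Longrightarrow> separable_field_factor scale e" "x * x = 0"
  shows "x = 0"
proof -
  have "e * x = 0" if "e \<in> E" for e
  proof (rule ccontr)
    assume ne: "e * x \<noteq> 0"
    then obtain y where y: "e * x * y = e"
      using separable_field_factor_inverse[OF assms(2)[OF \<open>e \<in> E\<close>]] by blast
    have "e * x = e * x * y * x" using y by simp
    also have "\<dots> = e * y * (x * x)" by (simp add: algebra_simps)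
    finally show False using ne assms(3) by simp
  qed
  then have "(\<Sum>e\<in>E. e * x) = 0" by simp
  then show ?thesis
    using assms(1) by (simp flip: sum_distrib_right)
qed

section \<open>Polynomial evaluation in an algebra and its field factors\<close>

context comm_algebra
begin

interpretation scalar: comm_ring_hom "\<lambda>s. scale s 1"
  by unfold_locales
    (simp_all add: scale_left_distrib flip: scale_mult_left)

interpretation map_scalar: map_poly_comm_ring_hom "\<lambda>s. scale s 1" ..

lemma alg_eval_eq_poly: "alg_eval scale p x = poly (map_poly (\<lambda>s. scale s 1) p) x"
proof -
  have "poly (map_poly (\<lambda>s. scale s 1) p) x = (\<Sum>i\<le>degree p. scale (coeff p i) 1 * x ^ i)"
    unfolding scalar.poly_map_poly_eval_poly by (simp add: eval_poly_as_sum mult.commute)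
  then show ?thesis
    by (simp add: alg_eval_def flip: scale_mult_left)
qed

lemma alg_eval_mult: "alg_eval scale (p * q) x = alg_eval scale p x * alg_eval scale q x"
  by (simp add: alg_eval_eq_poly map_scalar.hom_mult)

lemma alg_eval_add: "alg_eval scale (p + q) x = alg_eval scale p x + alg_eval scale q x"
  by (simp add: alg_eval_eq_poly map_scalar.hom_add)

lemma alg_eval_1: "alg_eval scale 1 x = 1"
  by (simp add: alg_eval_def)

lemma alg_eval_pCons: "alg_eval scale (pCons s p) x = scale s 1 + x * alg_eval scale p x"
  unfolding alg_eval_eq_poly by (subst Polynomial.map_poly_pCons) simp_all

lemma alg_eval_0: "alg_eval scale 0 x = 0"
  by (simp add: alg_eval_def)

text \<open>The condition on a field factor concerns elements \<open>e * x\<close> of the ideal;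
  this allows evaluation at \<open>x\<close> itself.\<close>

lemma idempotent_mult_alg_eval:
  assumes "e * e = e"
  shows "e * alg_eval scale p (e * x) = e * alg_eval scale p x"
proof (induction p)
  case 0
  show ?case by (simp add: alg_eval_0)
next
  case (pCons s p)
  have "e * alg_eval scale (pCons s p) (e * x) = e * scale s 1 + x * (e * e * alg_eval scale p (e * x))"
    by (simp add: alg_eval_pCons algebra_simps)
  also have "\<dots> = e * scale s 1 + x * (e * alg_eval scale p x)"
    using assms pCons.IH by simp
  finally show ?case
    by (simp add: alg_eval_pCons algebra_simps)
qed

text \<open>The polynomials that vanish at \<open>x\<close> in the factor of \<open>e\<close> are
  the multiples of a nonzero one of least degree, \<open>m\<close>. It is not a unit because
  \<open>e\<close> is nonzero, so the irreducible \<open>p\<close> is associated to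
  \<open>m\<close>.\<close>

lemma irreducible_annihilator_dvd:
  assumes "irreducible p" "e \<noteq> 0" and p: "e * alg_eval scale p x = 0" and g: "e * alg_eval scale g x = 0"
  shows "p dvd g"
proof -
  let ?J = "\<lambda>g. e * alg_eval scale g x = 0"
  have "p \<noteq> 0" using assms(1) by auto
  then obtain m where m: "?J m" "m \<noteq> 0"
    and least: "\<And>g. ?J g \<Longrightarrow> g \<noteq> 0 \<Longrightarrow> degree m \<le> degree g"
    using ex_has_least_nat[of "\<lambda>g. ?J g \<and> g \<noteq> 0" p degree] p by blast
  have dvd: "m dvd g" if "?J g" for g
  proof -
    have "e * alg_eval scale g x = e * alg_eval scale m x * alg_eval scale (g div m) x + e * alg_eval scale (g mod m) x"
      by (subst mult_div_mod_eq[of m g, symmetric])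
         (simp only: alg_eval_add alg_eval_mult algebra_simps)
    then have "?J (g mod m)" using that m by simp
    then show ?thesis
      using least[of "g mod m"] degree_mod_less'[of m g] m(2) by (metis mod_eq_0_iff_dvd not_le)
  qed
  then obtain k where k: "p = m * k" using p by (metis dvdE)
  have "\<not> m dvd 1"
  proof
    assume "m dvd 1"
    then obtain n where "1 = m * n" by (elim dvdE)
    then have "e = e * alg_eval scale m x * alg_eval scale n x"
      using alg_eval_mult[of m n x] by (simp add: alg_eval_1 mult.assoc)
    with m assms(2) show False by simp
  qed
  then have "k dvd 1" using assms(1) k irreducibleD by blast
  then have "p dvd m" unfolding k
    by (metis mult.right_neutral mult_dvd_mono dvd_refl)
  then show ?thesis using dvd[OF g] dvd_trans by blast
qed

end

section \<open>Invertibility of the derivative at the generator\<close>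

context monogenic_cubic_algebra
begin

lemma alg_eval_cubic: "alg_eval scale [:c, b, a, 1:] w = 0"
proof -
  have "alg_eval scale [:c, b, a, 1:] w = scale c 1 + w * comb b a 1"
    by (simp add: alg_eval_pCons alg_eval_0 comb_def power2_eq_square distrib_left flip: scale_mult_right)
  then show ?thesis
    by (simp add: w_mult_comb add_comb flip: comb_1) (simp add: comb_def)
qed

lemma alg_eval_quadratic: "alg_eval scale [:x, y, z:] w = comb x y z"
  by (simp add: alg_eval_pCons alg_eval_0 comb_def power2_eq_square distrib_left flip: scale_mult_right)

text \<open>A nonzero annihilator of smaller degree would be a linear relation between 1,
  \<open>w\<close> and \<open>w ^ 2\<close>.\<close>

lemma alg_eval_eq_0_imp_degree:
  assumes "alg_eval scale q w = 0" "q \<noteq> 0"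
  shows "degree q \<ge> 3"
proof (rule ccontr)
  assume "\<not> degree q \<ge> 3"
  then have q: "q = [:coeff q 0, coeff q 1, coeff q 2:]"
    by (intro poly_eqI) (auto simp: coeff_pCons numeral_2_eq_2 coeff_eq_0 split: nat.splits)
  then have "comb (coeff q 0) (coeff q 1) (coeff q 2) = comb 0 0 0"
    using assms(1) alg_eval_quadratic by (metis comb_1 scale_zero_left)
  then have "q = 0"
    by (subst q) (simp add: comb_eq_iff)
  with assms(2) show False by simp
qed

text \<open>A common root of \<open>f\<close> and \<open>f'\<close> in a field factor, with minimal polynomial \<open>p\<close>, forces
  \<open>p\<^sup>2\<close> to divide \<open>f\<close>; then \<open>(f / p)(w)\<close> is a nonzero nilpotent.\<close>

lemma deriv_unit:
  assumes sum: "\<Sum>E = 1" and E: "\<And>e. e \<in> E \<Longrightarrow> separable_field_factor scale e"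
  shows "comb b (2 * a) 3 dvd 1"
proof (rule inverse_mod_idempotents[OF sum])
  fix e assume "e \<in> E"
  note e = E[OF this]
  let ?f = "[:c, b, a, 1:]"
  have ee: "e * e = e" "e \<noteq> 0" using e by (auto simp: separable_field_factor_def)
  have f': "alg_eval scale (pderiv ?f) w = comb b (2 * a) 3"
    using alg_eval_quadratic[of b "2 * a" 3] by (simp add: pderiv_pCons)
  have "e * comb b (2 * a) 3 \<noteq> 0"
  proof
    assume 0: "e * comb b (2 * a) 3 = 0"
    have "\<exists>p. irreducible p \<and> e * alg_eval scale p (e * w) = 0 \<and> coprime p (pderiv p)"
      using e by (auto simp: separable_field_factor_def)
    then obtain p where p: "irreducible p" "e * alg_eval scale p w = 0" "coprime p (pderiv p)"
      using idempotent_mult_alg_eval[OF ee(1)] by auto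
    note p_dvd = irreducible_annihilator_dvd[OF p(1) ee(2) p(2)]
    have "\<not> p dvd 1" using p(1) by (auto simp: irreducible_def)
    have "p dvd ?f" by (rule p_dvd) (simp add: alg_eval_cubic)
    then obtain g where g: "?f = p * g" by (elim dvdE)
    have "p dvd pderiv ?f" by (rule p_dvd) (simp add: f' 0)
    \<comment> \<open>Product rule for f = p g; the first summand is a multiple of
      \<open>p\<close>.\<close>
    then have "p dvd p * pderiv g + g * pderiv p" by (simp only: g pderiv_mult)
    then have "p dvd g * pderiv p"
      using dvd_add_right_iff[of p "p * pderiv g"] dvd_triv_left by blast
    then obtain r where "g * pderiv p = p * r" by (elim dvdE)
    then have "e * (alg_eval scale g w * alg_eval scale (pderiv p) w) = 0"
      using p(2) by (simp flip: alg_eval_mult) (simp add: alg_eval_mult flip: mult.assoc)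
    \<comment> \<open>Separability: \<open>p\<close> is coprime to its derivative and not a unit, so
      the derivative does not vanish at \<open>w\<close> in this factor and is invertible
      there.\<close>
    moreover have "e * alg_eval scale (pderiv p) w \<noteq> 0"
      using p_dvd p(3) \<open>\<not> p dvd 1\<close> by (metis coprime_common_divisor dvd_refl)
    then obtain y where y: "e * alg_eval scale (pderiv p) w * y = e"
      using separable_field_factor_inverse[OF e] by blast
    ultimately have "e * alg_eval scale g w = 0"
      by (metis mult.assoc mult.commute mult_zero_left)
    then have "p dvd g" by (rule p_dvd)
    then obtain k where k: "g = p * k" by (elim dvdE)
    \<comment> \<open>With g = p k, the square of g is p g k = f k, which vanishes at
      \<open>w\<close>.\<close>
    have "alg_eval scale g w * alg_eval scale g w = alg_eval scale (?f * k) w"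
      unfolding g alg_eval_mult[symmetric] by (simp add: k algebra_simps)
    then have "alg_eval scale g w * alg_eval scale g w = 0"
      by (simp only: alg_eval_mult alg_eval_cubic mult_zero_left)
    then have "alg_eval scale g w = 0"
      using reduced_if_field_factors[OF sum E] by blast
    moreover have "g \<noteq> 0" "p \<noteq> 0" using g by auto
    \<comment> \<open>Reducedness gives g(w) = 0, so g has degree at least 3. As f = p g has degree
      3, this leaves only degree 0 for the irreducible \<open>p\<close>.\<close>
    ultimately have "degree g \<ge> 3"
      using alg_eval_eq_0_imp_degree by blast
    moreover have "degree p + degree g = 3"
      using degree_mult_eq[OF \<open>p \<noteq> 0\<close> \<open>g \<noteq> 0\<close>] by (simp flip: g)
    ultimately have "degree p = 0" by simp
    with \<open>\<not> p dvd 1\<close> \<open>p \<noteq> 0\<close> show False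
      by (simp add: is_unit_iff_degree)
  qed
  then show "\<exists>y. e * comb b (2 * a) 3 * y = e"
    using separable_field_factor_inverse[OF e] by blast
qed

end

text \<open>The span of 1, \<open>w\<close> and \<open>w ^ 2\<close> contains \<open>w ^ 3\<close>,
  hence is closed under multiplication and is a subalgebra containing \<open>w\<close>. As
  \<open>w\<close> generates, it is everything, and dimension 3 makes the powers a basis.\<close>

lemma (in finite_dim_comm_algebra) monogenic_cubic_algebra_if_generates:
  assumes dim: "dim UNIV = 3" and gen: "generates_algebra scale w"
  obtains a b c where "monogenic_cubic_algebra scale w a b c"
proof -
  interpret finite_dimensional_vector_space scale "set (alg_basis scale)"
    using basis_list_alg_basis by unfold_locales (auto simp: basis_list_def)
  let ?B = "{1, w, w ^ 2}"
  have in_span: "scale x 1 + scale y w + scale z (w ^ 2) \<in> span ?B" for x y z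
    by (intro span_add span_scale span_base) auto
  have span: "\<exists>x y z. u = scale x 1 + scale y w + scale z (w ^ 2)" if u: "u \<in> span ?B" for u
  proof -
    obtain x y z where "u - scale x 1 - scale y w - scale z (w ^ 2) = 0"
      using u by (auto simp: span_breakdown_eq)
    then show ?thesis
      by (intro exI[of _ x] exI[of _ y] exI[of _ z]) (simp add: algebra_simps)
  qed
  \<comment> \<open>Independent powers already span, as there are three of them. Otherwise a
    nontrivial relation expresses \<open>w ^ 2\<close> by lower powers, or shows that
    \<open>w\<close> is a scalar.\<close>
  have cube: "w ^ 3 \<in> span ?B"
  proof (cases "\<forall>x y z. scale x 1 + scale y w + scale z (w ^ 2) = 0 \<longrightarrow> x = 0 \<and> y = 0 \<and> z = 0")
    case True
    then have "independent ?B" "card ?B = 3"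
      using independent_powers_if_scalars_zero[of w] distinct_card[of "[1, w, w ^ 2]"] by auto
    then show ?thesis
      using card_ge_dim_independent[of ?B UNIV] dim by auto
  next
    case False
    then obtain x y z where rel: "scale x 1 + scale y w + scale z (w ^ 2) = 0"
      and nz: "\<not> (x = 0 \<and> y = 0 \<and> z = 0)" by blast
    show ?thesis
    proof (cases "z = 0")
      case False
      have "scale z (w ^ 2) = scale (- x) 1 + scale (- y) w"
        using rel by (simp add: algebra_simps eq_neg_iff_add_eq_0)
      then have "scale (1 / z) (scale z (w ^ 2)) = scale (1 / z) (scale (- x) 1 + scale (- y) w)"
        by simp
      then have w2: "w ^ 2 = scale (- x / z) 1 + scale (- y / z) w"
        using False by (simp add: scale_right_distrib scale_right_diff_distrib)
      have "w ^ 3 = w * w ^ 2" by (simp add: power2_eq_square power3_eq_cube mult.assoc)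
      also have "\<dots> = scale 0 1 + scale (- x / z) w + scale (- y / z) (w ^ 2)"
        by (subst w2) (simp add: distrib_left right_diff_distrib power2_eq_square flip: scale_mult_right)
      finally show ?thesis using in_span by metis
    next
      case True
      then have "y \<noteq> 0" using rel nz by auto
      have "scale y w = scale (- x) 1"
        using rel True by (simp add: algebra_simps eq_neg_iff_add_eq_0)
      then have "scale (1 / y) (scale y w) = scale (1 / y) (scale (- x) 1)" by simp
      then have w: "w = scale (- x / y) 1" using \<open>y \<noteq> 0\<close> by simp
      obtain s where "w = scale s 1" using w by blast
      then have "w ^ 3 = scale (s * s * s) 1"
        by (simp add: power3_eq_cube mult.assoc flip: scale_mult_left)
      then show ?thesis by (simp add: span_scale span_base)
    qed
  qed
  have w_mult: "w * u \<in> span ?B" if u: "u \<in> span ?B" for u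
  proof -
    obtain x y z where "u = scale x 1 + scale y w + scale z (w ^ 2)" using span[OF u] by blast
    then have "w * u = (scale 0 1 + scale x w + scale y (w ^ 2)) + scale z (w ^ 3)"
      by (simp add: distrib_left flip: scale_mult_right)
         (simp add: power2_eq_square power3_eq_cube mult.assoc)
    then show ?thesis using cube in_span by (metis span_add span_scale)
  qed
  have "u * v \<in> span ?B" if "u \<in> span ?B" "v \<in> span ?B" for u v
  proof -
    obtain x y z where "u = scale x 1 + scale y w + scale z (w ^ 2)" using span[OF \<open>u \<in> _\<close>] by blast
    then have "u * v = scale x v + scale y (w * v) + scale z (w * (w * v))"
      by (simp add: distrib_right power2_eq_square mult.assoc flip: scale_mult_left)
    then show ?thesis
      using w_mult that(2) by (simp add: span_add span_scale)
  qed
  then have "subalgebra scale (span ?B)"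
    unfolding subalgebra_def by (auto intro: span_base)
  then have "subalgebra scale hull {w} \<subseteq> span ?B"
    by (intro hull_minimal) (auto intro: span_base)
  then have UNIV: "span ?B = UNIV"
    using gen by (auto simp: generates_algebra_def)
  have "3 \<le> card ?B"
    using dim_le_card[of UNIV ?B] UNIV dim by simp
  \<comment> \<open>A priori the powers could coincide; a spanning set in dimension 3 must have
    three elements.\<close>
  moreover have "card (set [1, w, w ^ 2]) \<le> 3"
    by (rule order.trans[OF card_length]) simp
  ultimately have card: "card ?B = 3" by simp
  then have d: "1 \<noteq> w" "1 \<noteq> w ^ 2" "w \<noteq> w ^ 2"
    using card_distinct[of "[1, w, w ^ 2]"] by auto
  have ind: "independent ?B"
    using card_le_dim_spanning[of ?B UNIV] UNIV card dim by simp
  obtain x y z where cubic: "w ^ 3 = scale x 1 + scale y w + scale z (w ^ 2)"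
    using span[OF cube] by blast
  \<comment> \<open>The signs turn the expression for \<open>w ^ 3\<close> into the vanishing of a
    monic cubic at \<open>w\<close>.\<close>
  have "monogenic_cubic_algebra scale w (- z) (- y) (- x)"
  proof unfold_locales
    fix x y z assume 0: "scale x 1 + scale y w + scale z (w ^ 2) = 0"
    let ?g = "\<lambda>v. if v = 1 then x else if v = w then y else z"
    have sum: "(\<Sum>v\<in>?B. scale (?g v) v) = 0"
      using 0 d by (auto simp: add.assoc)
    have "?g v = 0" if "v \<in> ?B" for v
      by (rule independentD[OF ind _ _ sum that]) auto
    from this[of 1] this[of w] this[of "w ^ 2"] show "x = 0 \<and> y = 0 \<and> z = 0"
      using d by (simp split: if_splits)
  next
    show "\<exists>x y z. u = scale x 1 + scale y w + scale z (w ^ 2)" for u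
      using span[of u] UNIV by blast
  next
    show "w ^ 3 = - scale (- z) (w ^ 2) - scale (- y) w - scale (- x) 1"
      using cubic by (simp add: algebra_simps)
  qed
  then show ?thesis by (rule that)
qed

section \<open>Cube roots in finite fields\<close>

text \<open>Multiplication by \<open>x\<close> permutes the nonzero elements; comparing their
  products gives the claim.\<close>

lemma power_card_minus_1_eq_1:
  fixes x :: "'k::{field,finite}"
  assumes "x \<noteq> 0"
  shows "x ^ (CARD('k) - 1) = 1"
proof -
  let ?U = "UNIV - {0 :: 'k}"
  have "bij_betw ((*) x) ?U ?U"
    using assms by (intro bij_betwI[where g = "\<lambda>y. y / x"]) auto
  then have "(\<Prod>y\<in>?U. x * y) = \<Prod>?U"
    by (rule prod.reindex_bij_betw)
  then have "x ^ card ?U * \<Prod>?U = \<Prod>?U"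
    by (simp add: prod.distrib)
  moreover have "\<Prod>?U \<noteq> 0" by simp
  ultimately show ?thesis by (simp add: card_Diff_singleton)
qed

text \<open>With q - 1 = 3 m + 1, a cube root of unity x satisfies 1 = x^(3 m + 1) = x. Cubing is
  thus injective, and bijective by finiteness.\<close>

lemma card_cube_roots_2_mod_3:
  fixes d :: "'k::{field,finite}"
  assumes "CARD('k) mod 3 = 2" "d \<noteq> 0"
  shows "card {u. u \<noteq> 0 \<and> u ^ 3 = d} = 1"
proof -
  define m where "m = CARD('k) div 3"
  have m: "CARD('k) - 1 = 3 * m + 1"
    using assms(1) unfolding m_def by presburger
  have one: "x = 1" if "x ^ 3 = 1" for x :: 'k
  proof -
    have "x \<noteq> 0" using that by auto
    then have "1 = x * (x ^ 3) ^ m"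
      using power_card_minus_1_eq_1[of x] m by (simp flip: power_mult)
    then show ?thesis using that by simp
  qed
  have inj: "inj (\<lambda>u::'k. u ^ 3)"
  proof (rule injI)
    fix x y :: 'k assume eq: "x ^ 3 = y ^ 3"
    show "x = y"
    proof (cases "y = 0")
      case False
      then have "(x / y) ^ 3 = 1" using eq by (simp add: power_divide)
      then show ?thesis using one[of "x / y"] False by simp
    qed (use eq in simp)
  qed
  then have "surj (\<lambda>u::'k. u ^ 3)" by (simp add: finite_UNIV_inj_surj)
  then obtain v where v: "d = v ^ 3" by (elim surjE) auto
  have "{u. u \<noteq> 0 \<and> u ^ 3 = d} = {v}"
    using v assms(2) injD[OF inj] by auto
  then show ?thesis by simp
qed

text \<open>With q - 1 = 3 m, the polynomial T^m - 1 has too few roots to kill all nonzero y. Some t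
  = y^m is therefore a nontrivial cube root of unity, and the cube roots of \<open>d\<close> are v,
  t v and t^2 v.\<close>

lemma card_cube_roots_1_mod_3:
  fixes d :: "'k::{field,finite}"
  assumes "CARD('k) mod 3 = 1" "v \<noteq> 0" "d = v ^ 3"
  shows "card {u. u \<noteq> 0 \<and> u ^ 3 = d} = 3"
proof -
  define m where "m = CARD('k) div 3"
  have m: "CARD('k) - 1 = m * 3"
    using assms(1) unfolding m_def by presburger
  have "card {0, 1 :: 'k} \<le> CARD('k)" by (rule card_mono) auto
  then have "m > 0" using m by (cases m) auto
  let ?p = "monom 1 m - 1 :: 'k poly"
  have "coeff ?p m = 1" using \<open>m > 0\<close> by simp
  then have "?p \<noteq> 0" by (metis coeff_0 zero_neq_one)
  have "degree ?p \<le> m"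
    by (intro degree_diff_le) (auto simp: degree_monom_le)
  then have "card {x. poly ?p x = 0} \<le> m"
    using card_poly_roots_bound[OF \<open>?p \<noteq> 0\<close>] by simp
  also have "m < card (UNIV - {0 :: 'k})"
    using m \<open>m > 0\<close> by (simp add: card_Diff_singleton)
  finally have "\<not> UNIV - {0} \<subseteq> {x. poly ?p x = 0}"
    using card_mono[of "{x. poly ?p x = 0}" "UNIV - {0}"] by auto
  then obtain y :: 'k where y: "y \<noteq> 0" "y ^ m \<noteq> 1"
    by (auto simp: poly_monom)
  define t where "t = y ^ m"
  have t3: "t ^ 3 = 1"
    using power_card_minus_1_eq_1[OF y(1)] m by (simp add: t_def flip: power_mult)
  have "(t - 1) * (t ^ 2 + t + 1) = t ^ 3 - 1"
    by (simp add: algebra_simps power2_eq_square power3_eq_cube)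
  then have t: "t ^ 2 + t + 1 = 0" and "t \<noteq> 1"
    using t3 y(2) by (auto simp: t_def)
  have "t \<noteq> 0" using t3 by auto
  have "t ^ 2 \<noteq> 1" 
  proof
    assume "t ^ 2 = 1"
    then have "t ^ 3 = t" by (simp add: power2_eq_square power3_eq_cube)
    with t3 \<open>t \<noteq> 1\<close> show False by simp
  qed
  have "{u. u \<noteq> 0 \<and> u ^ 3 = d} = {v, t * v, t ^ 2 * v}"
  proof (intro equalityI subsetI)
    fix u assume "u \<in> {u. u \<noteq> 0 \<and> u ^ 3 = d}"
    then have u: "u ^ 3 = v ^ 3" using assms by simp
    have t2: "t ^ 2 = - t - 1" using t by (simp add: algebra_simps eq_neg_iff_add_eq_0)
    \<comment> \<open>Factorization of u^3 - v^3 into linear factors, using t^2 = - t - 1 and t^3 =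
      1.\<close>
    have "(u - v) * ((u - t * v) * (u - t ^ 2 * v)) =
        (u - v) * (u ^ 2 - (t + t ^ 2) * u * v + t ^ 3 * v ^ 2)"
      by (simp add: algebra_simps power2_eq_square power3_eq_cube)
    also have "\<dots> = u ^ 3 - v ^ 3"
      unfolding t2 t3 by (simp add: algebra_simps power2_eq_square power3_eq_cube)
    finally have "(u - v) * ((u - t * v) * (u - t ^ 2 * v)) = 0" using u by simp
    then show "u \<in> {v, t * v, t ^ 2 * v}" by auto
  next
    fix u assume "u \<in> {v, t * v, t ^ 2 * v}"
    moreover have "(t ^ 2) ^ 3 = (t ^ 3) ^ 2" by (simp flip: power_mult)
    ultimately show "u \<in> {u. u \<noteq> 0 \<and> u ^ 3 = d}"
      using assms \<open>t \<noteq> 0\<close> t3 by (auto simp: power_mult_distrib)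
  qed
  moreover have "card {v, t * v, t ^ 2 * v} = 3"
    using \<open>v \<noteq> 0\<close> \<open>t \<noteq> 1\<close> \<open>t ^ 2 \<noteq> 1\<close> \<open>t \<noteq> 0\<close> by (auto simp: power2_eq_square)
  ultimately show ?thesis by simp
qed

section \<open>Counting\<close>

context monogenic_cubic_algebra
begin

text \<open>The map from \<open>u\<close> to \<open>scale u v\<close>, with \<open>v\<close> the
  inverse of \<gamma> f'(w), is a bijection from the cube roots to the singular fiber.\<close>

lemma card_X_sing_fiber:
  assumes three: "(3::'a) \<noteq> 0" and \<gamma>: "\<gamma> dvd 1" and deriv: "comb b (2 * a) 3 dvd 1" and \<delta>: "\<delta> \<noteq> 0"
  shows "card (X_sing scale w {\<delta>} \<gamma>) =
    card {u. u \<noteq> 0 \<and> u ^ 3 = - (alg_norm scale \<gamma> * \<delta> * elem_disc scale w)}" (is "_ = card ?U")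
proof -
  define d where "d = comb b (2 * a) 3"
  have norm_d: "alg_norm scale d = - elem_disc scale w"
    unfolding d_def by (rule alg_norm_deriv[OF three])
  have "\<gamma> * d dvd 1" using \<gamma> deriv unfolding d_def by (metis mult_1_left mult_dvd_mono)
  then obtain v where v: "\<gamma> * d * v = 1" by (metis dvdE)
  have nz: "alg_norm scale \<gamma> \<noteq> 0" "elem_disc scale w \<noteq> 0"
    using alg_norm_unit_nonzero[OF \<gamma>] alg_norm_unit_nonzero[OF deriv] norm_d by (auto simp: d_def)
  have scalar: "\<gamma> * h * d = scale u 1 \<longleftrightarrow> h = scale u v" for h u
  proof
    assume u: "\<gamma> * h * d = scale u 1"
    have "(\<gamma> * d * v) * h = v * (\<gamma> * h * d)" by (simp add: algebra_simps)
    then show "h = scale u v" using v u by (simp flip: scale_mult_right)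
  next
    assume "h = scale u v"
    then have "\<gamma> * h * d = scale u (\<gamma> * d * v)"
      by (simp add: scale_mult_right mult.commute mult.left_commute)
    then show "\<gamma> * h * d = scale u 1" using v by simp
  qed
  \<comment> \<open>Norm of both sides of the equation in \<open>scalar\<close>; a scalar
    \<open>u\<close> has norm \<open>u ^ 3\<close> in dimension 3.\<close>
  have norm: "- (alg_norm scale \<gamma> * alg_norm scale (scale u v) * elem_disc scale w) = u ^ 3" for u
  proof -
    have "alg_norm scale (\<gamma> * scale u v * d) = u ^ 3"
      using scalar by (metis alg_norm_scale_1)
    then show ?thesis by (simp add: alg_norm_mult norm_d)
  qed
  have unit: "scale u v dvd 1" if "u \<noteq> 0" for u
  proof -
    have "scale u v * scale (1 / u) (\<gamma> * d) = scale (u * (1 / u)) (\<gamma> * d * v)"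
      by (simp add: mult.commute flip: scale_mult_right scale_mult_left)
    also have "\<dots> = 1" using that v by simp
    finally show ?thesis by (metis dvd_triv_left)
  qed
  have "X_sing scale w {\<delta>} \<gamma> = {h. h dvd 1 \<and> alg_norm scale h = \<delta> \<and> (\<exists>u. \<gamma> * h * d = scale u 1)}"
    unfolding X_sing_def X_set_def d_def trace_zero_iff_mult_deriv_scalar[symmetric] mult.assoc[of w]
    by auto
  also have "\<dots> = {scale u v | u. scale u v dvd 1 \<and> alg_norm scale (scale u v) = \<delta>}"
    unfolding scalar by blast
  also have "\<dots> = (\<lambda>u. scale u v) ` ?U"
  proof -
    have "scale u v dvd 1 \<and> alg_norm scale (scale u v) = \<delta> \<longleftrightarrow> u \<in> ?U" for u
    proof -
      have "u ^ 3 = - (alg_norm scale \<gamma> * \<delta> * elem_disc scale w) \<longleftrightarrow> alg_norm scale (scale u v) = \<delta>"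
        using nz by (simp flip: norm)
      moreover have "u \<noteq> 0" if "scale u v dvd 1"
        using that by (auto elim: dvdE)
      ultimately show ?thesis using unit by auto
    qed
    then show ?thesis by auto
  qed
  also have "card \<dots> = card ?U"
  proof (rule card_image, rule inj_onI)
    fix u u' assume "scale u v = scale u' v"
    then have "scale u 1 = scale u' 1" using scalar by metis
    then show "u = u'" by simp
  qed
  finally show ?thesis .
qed

end

context finite_dim_comm_algebra
begin

text \<open>Multiplication by \<gamma> is a bijection onto the trace-zero units of the scaled norm,
  with multiplication by the inverse of \<gamma> as its inverse.\<close>

lemma card_X_set_fiber:
  assumes "\<gamma> dvd 1"
  shows "card (X_set scale {\<delta>} \<gamma>) = trace_zero_count scale (alg_norm scale \<gamma> * \<delta>)"
proof -
  obtain v where v: "\<gamma> * v = 1" using assms by (metis dvdE)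
  have nz: "alg_norm scale \<gamma> \<noteq> 0" by (rule alg_norm_unit_nonzero[OF assms])
  define T where
    "T = {x. x dvd 1 \<and> alg_trace scale x = 0 \<and> alg_norm scale x = alg_norm scale \<gamma> * \<delta>}"
  have mem: "h \<in> X_set scale {\<delta>} \<gamma> \<longleftrightarrow> \<gamma> * h \<in> T" for h
    using nz assms by (auto simp: X_set_def T_def alg_norm_mult)
  have inv: "\<gamma> * (v * x) = x" "v * (\<gamma> * x) = x" for x
    using v by (simp_all add: mult.commute[of v \<gamma>] flip: mult.assoc)
  have "bij_betw ((*) \<gamma>) (X_set scale {\<delta>} \<gamma>) T"
    by (rule bij_betwI[where g = "(*) v"]) (auto simp: mem inv)
  then show ?thesis
    unfolding trace_zero_count_def T_def by (rule bij_betw_same_card)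
qed

text \<open>Both sets are finite disjoint unions of their fibers under the norm.\<close>

lemma card_X_set_sum:
  assumes "finite (UNIV :: 'a set)"
  shows "card (X_set scale C \<gamma>) = (\<Sum>\<delta>\<in>C. card (X_set scale {\<delta>} \<gamma>))"
    and "card (X_sing scale \<omega> C \<gamma>) = (\<Sum>\<delta>\<in>C. card (X_sing scale \<omega> {\<delta>} \<gamma>))"
proof -
  have fin: "finite C" "finite (A :: 'b set)" for A
    by (rule finite_subset[OF subset_UNIV assms],
        rule finite_subset[OF subset_UNIV finite_UNIV_algebra[OF assms]])
  have "X_set scale C \<gamma> = (\<Union>\<delta>\<in>C. X_set scale {\<delta>} \<gamma>)"
    and "X_sing scale \<omega> C \<gamma> = (\<Union>\<delta>\<in>C. X_sing scale \<omega> {\<delta>} \<gamma>)"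
    by (auto simp: X_set_def X_sing_def)
  then show "card (X_set scale C \<gamma>) = (\<Sum>\<delta>\<in>C. card (X_set scale {\<delta>} \<gamma>))"
    and "card (X_sing scale \<omega> C \<gamma>) = (\<Sum>\<delta>\<in>C. card (X_sing scale \<omega> {\<delta>} \<gamma>))"
    using fin by (auto simp: X_set_def X_sing_def intro!: card_UN_disjoint)
qed

end

theorem theorem4p4:
  fixes scale :: "'k::{field,finite} \<Rightarrow> 'b::comm_ring_1 \<Rightarrow> 'b"
    and \<gamma> \<omega> :: 'b and C :: "'k set"
  assumes "finite_etale_cubic_algebra scale"
    and "CHAR('k) \<noteq> 2" and "CHAR('k) \<noteq> 3"
    and "\<gamma> dvd 1"
    and "generates_algebra scale \<omega>"
    and "C \<subseteq> {\<delta>. \<delta> \<noteq> 0}" and "C \<noteq> {}"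
  shows "card (X_sing scale \<omega> C \<gamma>) =
           (\<Sum>\<delta>\<in>C. card {u::'k. u \<noteq> 0 \<and> u ^ 3 = - (alg_norm scale \<gamma> * \<delta> * elem_disc scale \<omega>)}) \<and>
         card (X_set scale C \<gamma>) = (\<Sum>\<delta>\<in>C. trace_zero_count scale (alg_norm scale \<gamma> * \<delta>)) \<and>
         int (card (X_set scale C \<gamma> - X_sing scale \<omega> C \<gamma>)) =
           int (\<Sum>\<delta>\<in>C. trace_zero_count scale (alg_norm scale \<gamma> * \<delta>)) -
           int (\<Sum>\<delta>\<in>C. card {u::'k. u \<noteq> 0 \<and> u ^ 3 = - (alg_norm scale \<gamma> * \<delta> * elem_disc scale \<omega>)}) \<and>
         (\<forall>\<delta>. \<delta> \<noteq> 0 \<longrightarrow>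
           (CARD('k) mod 3 = 2 \<longrightarrow> card (X_sing scale \<omega> {\<delta>} \<gamma>) = 1) \<and>
           (CARD('k) mod 3 = 1 \<and>
              - (alg_norm scale \<gamma> * \<delta> * elem_disc scale \<omega>) \<in> {u ^ 3 | u. u \<noteq> 0} \<longrightarrow>
              card (X_sing scale \<omega> {\<delta>} \<gamma>) = 3) \<and>
           (CARD('k) mod 3 = 1 \<and>
              - (alg_norm scale \<gamma> * \<delta> * elem_disc scale \<omega>) \<notin> {u ^ 3 | u. u \<noteq> 0} \<longrightarrow>
              card (X_sing scale \<omega> {\<delta>} \<gamma>) = 0))"
proof -
  have "comm_algebra scale"
    using assms(1) by (auto simp: finite_etale_cubic_algebra_def finite_etale_algebra_def)
  then interpret comm_algebra scale .
  have dim: "dim UNIV = 3" and "\<exists>S. finite S \<and> span S = UNIV"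
    using assms(1) by (auto simp: finite_etale_cubic_algebra_def finite_etale_algebra_def)
  then have "basis_list scale (alg_basis scale)"
    using basis_list_alg_basisI comm_algebra_axioms by blast
  then interpret finite_dim_comm_algebra scale
    by unfold_locales
  obtain a b c where "monogenic_cubic_algebra scale \<omega> a b c"
    using monogenic_cubic_algebra_if_generates[OF dim assms(5)] .
  then interpret monogenic_cubic_algebra scale \<omega> a b c .
  obtain E where "\<Sum>E = 1" "\<forall>e\<in>E. separable_field_factor scale e"
    using assms(1) by (auto simp: finite_etale_cubic_algebra_def finite_etale_algebra_def)
  then have deriv: "comb b (2 * a) 3 dvd 1"
    using deriv_unit by blast
  have three: "(3::'k) \<noteq> 0"
  proof
    assume "(3::'k) = 0"
    then have "of_nat 3 = (0::'k)" by simp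
    then have "CHAR('k) dvd 3" by (simp only: of_nat_eq_0_iff_char_dvd)
    moreover have "prime (3::nat)" by simp
    ultimately have "CHAR('k) = 1 \<or> CHAR('k) = 3" by (auto simp: prime_nat_iff)
    then show False using assms(3) by auto
  qed
  let ?D = "\<lambda>\<delta>. - (alg_norm scale \<gamma> * \<delta> * elem_disc scale \<omega>)"
  note sing = card_X_sing_fiber[OF three assms(4) deriv]
  \<comment> \<open>The discriminant is nonzero because its negative is the norm of the unit
    f'(\<omega>).\<close>
  have D: "?D \<delta> \<noteq> 0" if "\<delta> \<noteq> 0" for \<delta>
    using that alg_norm_unit_nonzero[OF assms(4)] alg_norm_unit_nonzero[OF deriv] alg_norm_deriv[OF three]
    by auto
  have count_sing: "card (X_sing scale \<omega> C \<gamma>) = (\<Sum>\<delta>\<in>C. card {u. u \<noteq> 0 \<and> u ^ 3 = ?D \<delta>})"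
    by (subst card_X_set_sum(2)[OF finite]) (intro sum.cong refl sing, use assms(6) in auto)
  have count_all: "card (X_set scale C \<gamma>) = (\<Sum>\<delta>\<in>C. trace_zero_count scale (alg_norm scale \<gamma> * \<delta>))"
    by (subst card_X_set_sum(1)[OF finite]) (intro sum.cong refl card_X_set_fiber assms(4))
  have fin: "finite (A :: 'b set)" for A
    by (rule finite_subset[OF subset_UNIV finite_UNIV_algebra[OF finite]])
  have sub: "X_sing scale \<omega> C \<gamma> \<subseteq> X_set scale C \<gamma>"
    by (auto simp: X_sing_def)
  have count_diff: "int (card (X_set scale C \<gamma> - X_sing scale \<omega> C \<gamma>)) =
      int (card (X_set scale C \<gamma>)) - int (card (X_sing scale \<omega> C \<gamma>))"
    using card_Diff_subset[OF fin sub] card_mono[OF fin sub] by simp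
  have fibers: "(CARD('k) mod 3 = 2 \<longrightarrow> card (X_sing scale \<omega> {\<delta>} \<gamma>) = 1) \<and>
      (CARD('k) mod 3 = 1 \<and> ?D \<delta> \<in> {u ^ 3 | u. u \<noteq> 0} \<longrightarrow> card (X_sing scale \<omega> {\<delta>} \<gamma>) = 3) \<and>
      (CARD('k) mod 3 = 1 \<and> ?D \<delta> \<notin> {u ^ 3 | u. u \<noteq> 0} \<longrightarrow> card (X_sing scale \<omega> {\<delta>} \<gamma>) = 0)"
    if "\<delta> \<noteq> 0" for \<delta>
  proof (intro conjI impI)
    assume "CARD('k) mod 3 = 2"
    then show "card (X_sing scale \<omega> {\<delta>} \<gamma>) = 1"
      unfolding sing[OF that] by (rule card_cube_roots_2_mod_3) (rule D[OF that])
  next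
    assume "CARD('k) mod 3 = 1 \<and> ?D \<delta> \<in> {u ^ 3 | u. u \<noteq> 0}"
    then show "card (X_sing scale \<omega> {\<delta>} \<gamma>) = 3"
      unfolding sing[OF that] using card_cube_roots_1_mod_3 by blast
  next
    assume "CARD('k) mod 3 = 1 \<and> ?D \<delta> \<notin> {u ^ 3 | u. u \<noteq> 0}"
    then have "{u. u \<noteq> 0 \<and> u ^ 3 = ?D \<delta>} = {}" by force
    then show "card (X_sing scale \<omega> {\<delta>} \<gamma>) = 0"
      unfolding sing[OF that] by (simp only: card.empty)
  qed
  show ?thesis
    unfolding count_diff using count_sing count_all fibers by simp
qed

end
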